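(* Let $H$ be an infinite dimensional complex Hilbert space and let $T\in\mathcal{AM}^+(H)$, i.e. $T\in\mathcal{B}(H)$ is positive and absolutely minimum attaining. Then there is an orthonormal basis $\{u_\lambda:\lambda\in\Lambda\}$ of $H$ and scalars $\alpha_\lambda$ ($\lambda\in\Lambda$) with $Tu_\lambda=\alpha_\lambda u_\lambda$ for all $\lambda\in\Lambda$, so that $$Tx=\sum_{\lambda\in\Lambda}\alpha_\lambda\langle x,u_\lambda\rangle u_\lambda\quad\text{for all }x\in H,$$ and the following hold: (1) for every nonempty subset $\Gamma$ of $\Lambda$, $\inf\{\alpha_\lambda:\lambda\in\Gamma\}=\min\{\alpha_\lambda:\lambda\in\Gamma\}$ (the infimum is attained); (2) the spectrum $\sigma(T)=\overline{\{\alpha_\lambda:\lambda\in\Lambda\}}$ of $T$ has at most one limit point; moreover, this unique limit point (if it exists) can only be the limit of an increasing sequence in the spectrum (i.e. it is the limit of an increasing sequence of elements of $\sigma(T)$, and it is not the limit of any sequence of elements of $\sigma(T)$ that are strictly greater than it); (3) the point spectrum $\sigma_p(T)$ of $T$ is countable, and there can exist at most one eigenvalue of $T$ with infinite multiplicity; (4) if $\sigma(T)$ has a limit point $\alpha$ and $T$ has an eigenvalue $\hat\alpha$ with infinite multiplicity, then $\alpha=\hat\alpha$.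
   Context: $\mathcal{B}(H)$ is the space of bounded linear operators on $H$ ($H$ is not assumed separable). $T\in\mathcal{B}(H)$ is positive ($T\ge 0$) if $T=T^*$ and $\langle Tx,x\rangle\ge 0$ for all $x\in H$. For a bounded operator $T:H_1\to H_2$ between complex Hilbert spaces, the minimum modulus is $m(T)=\inf\{\|Tx\|: x\in H_1,\ \|x\|=1\}$; $T$ is minimum attaining if there is $x_0\in H_1$ with $\|x_0\|=1$ and $\|Tx_0\|=m(T)$; $T$ is absolutely minimum attaining if the restriction $T|_M:M\to H_2$ is minimum attaining for every nonzero closed subspace $M$ of $H_1$. $\mathcal{AM}^+(H)$ is the set of positive absolutely minimum attaining operators in $\mathcal{B}(H)$. $\sigma_p(T)=\{\lambda\in\mathbb{C}:T-\lambda I\text{ is not injective}\}$; the multiplicity of an eigenvalue $\lambda$ is $\dim N(T-\lambda I)$, where $N$ denotes null space. Limit point means accumulation point; countable means finite or countably infinite. *)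

theory Defs
  imports "HOL-Analysis.Analysis"
begin

text \<open>
  A complex inner product space is presented as a real inner product space carrying a compatible
  complex structure. Every complex inner product space arises this way, its real inner product
  being the real part of the complex one; so the norm \<open>sqrt (x \<bullet> x)\<close>, and with it the metric and
  the topology, are the usual ones. The form \<open>cinner\<close> is linear in its first argument and
  conjugate linear in its second.
\<close>

class complex_inner = real_inner +
  fixes scaleC :: "complex \<Rightarrow> 'a \<Rightarrow> 'a"  (infixr \<open>*\<^sub>C\<close> 75)
    and cinner :: "'a \<Rightarrow> 'a \<Rightarrow> complex"
  assumes scaleC_add_right: "a *\<^sub>C (x + y) = a *\<^sub>C x + a *\<^sub>C y"
    and scaleC_add_left: "(a + b) *\<^sub>C x = a *\<^sub>C x + b *\<^sub>C x"
    and scaleC_scaleC: "a *\<^sub>C b *\<^sub>C x = (a * b) *\<^sub>C x"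
    and scaleC_of_real: "complex_of_real r *\<^sub>C x = r *\<^sub>R x"
    and cinner_commute: "cinner x y = cnj (cinner y x)"
    and cinner_add_left: "cinner (x + y) z = cinner x z + cinner y z"
    and cinner_scaleC_left: "cinner (a *\<^sub>C x) y = a * cinner x y"
    and Re_cinner: "Re (cinner x y) = x \<bullet> y"

class chilbert_space = complex_inner + complete_space

lemma scaleC_one: "1 *\<^sub>C x = (x::'a::complex_inner)"
  using scaleC_of_real[of 1 x] by simp

global_interpretation complex_vector:
  vector_space "scaleC :: complex \<Rightarrow> 'a \<Rightarrow> 'a::complex_inner"
  defines csubspace = complex_vector.subspace
    and cspan = complex_vector.span
  by unfold_locales (simp_all add: scaleC_add_right scaleC_add_left scaleC_scaleC scaleC_one)

text \<open>Meant for complex subspaces only. The \<open>nat\<close>-valued \<open>complex_vector.dim\<close> would not do: it is \<open>0\<close> for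
  infinite dimensional spaces.\<close>

definition cfinite_dim :: "'a::complex_inner set \<Rightarrow> bool" where
  "cfinite_dim S \<longleftrightarrow> (\<exists>B. finite B \<and> cspan B = S)"

definition orthonormal_family :: "'i set \<Rightarrow> ('i \<Rightarrow> 'a::complex_inner) \<Rightarrow> bool" where
  "orthonormal_family \<Lambda> u \<longleftrightarrow>
     (\<forall>i\<in>\<Lambda>. \<forall>j\<in>\<Lambda>. cinner (u i) (u j) = (if i = j then 1 else 0))"

definition orthonormal_basis :: "'i set \<Rightarrow> ('i \<Rightarrow> 'a::complex_inner) \<Rightarrow> bool" where
  "orthonormal_basis \<Lambda> u \<longleftrightarrow> orthonormal_family \<Lambda> u \<and> closure (cspan (u ` \<Lambda>)) = UNIV"

definition bounded_clinear :: "('a::complex_inner \<Rightarrow> 'b::complex_inner) \<Rightarrow> bool" where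
  "bounded_clinear T \<longleftrightarrow> bounded_linear T \<and> (\<forall>c x. T (c *\<^sub>C x) = c *\<^sub>C T x)"

definition cadjoint :: "('a::complex_inner \<Rightarrow> 'b::complex_inner) \<Rightarrow> 'b \<Rightarrow> 'a" where
  "cadjoint T = (SOME S. \<forall>x y. cinner (T x) y = cinner x (S y))"

lemma cadjoint_unique:
  assumes "\<And>x y. cinner (T x) y = cinner x (S y)"
  shows "cadjoint T = S"
proof -
  have *: "R = S" if R: "\<forall>x y. cinner (T x) y = cinner x (R y)" for R
  proof
    fix y
    have eq: "x \<bullet> R y = x \<bullet> S y" for x
    proof -
      have "cinner x (R y) = cinner x (S y)"
        by (rule trans[OF R[rule_format, symmetric] assms])
      then show ?thesis
        by (simp only: Re_cinner[symmetric])
    qed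
    have "(R y - S y) \<bullet> (R y - S y) = 0"
      by (subst inner_diff_right) (simp only: eq diff_self)
    then show "R y = S y"
      by simp
  qed
  show ?thesis
    unfolding cadjoint_def
    by (rule some_equality) (fact allI[OF allI, OF assms], fact *)
qed

definition positive_operator :: "('a::complex_inner \<Rightarrow> 'a) \<Rightarrow> bool" where
  "positive_operator T \<longleftrightarrow>
     bounded_clinear T \<and> T = cadjoint T \<and> (\<forall>x. cinner (T x) x \<in> \<real>\<^sub>\<ge>\<^sub>0)"

text \<open>The minimum modulus \<open>m(T|\<^sub>M)\<close> of the restriction of \<open>T\<close> to a subspace \<open>M \<noteq> {0}\<close>.\<close>

definition minimum_modulus_on ::
    "'a::complex_inner set \<Rightarrow> ('a \<Rightarrow> 'b::complex_inner) \<Rightarrow> real" where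
  "minimum_modulus_on M T = Inf {norm (T x) |x. x \<in> M \<and> norm x = 1}"

definition minimum_attaining_on ::
    "'a::complex_inner set \<Rightarrow> ('a \<Rightarrow> 'b::complex_inner) \<Rightarrow> bool" where
  "minimum_attaining_on M T \<longleftrightarrow>
     (\<exists>x\<^sub>0\<in>M. norm x\<^sub>0 = 1 \<and> norm (T x\<^sub>0) = minimum_modulus_on M T)"

definition absolutely_minimum_attaining ::
    "('a::complex_inner \<Rightarrow> 'b::complex_inner) \<Rightarrow> bool" where
  "absolutely_minimum_attaining T \<longleftrightarrow>
     (\<forall>M. csubspace M \<and> closed M \<and> M \<noteq> {0} \<longrightarrow> minimum_attaining_on M T)"

definition AM_plus :: "('a::chilbert_space \<Rightarrow> 'a) set" where
  "AM_plus = {T. positive_operator T \<and> absolutely_minimum_attaining T}"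

definition spectrum :: "('a::complex_inner \<Rightarrow> 'a) \<Rightarrow> complex set" where
  "spectrum T =
     {z. \<not> (\<exists>S. bounded_clinear S \<and> (\<forall>x. S (T x - z *\<^sub>C x) = x) \<and> (\<forall>x. T (S x) - z *\<^sub>C S x = x))}"

definition point_spectrum :: "('a::complex_inner \<Rightarrow> 'a) \<Rightarrow> complex set" where
  "point_spectrum T = {z. \<not> inj (\<lambda>x. T x - z *\<^sub>C x)}"

definition eigenspace :: "('a::complex_inner \<Rightarrow> 'a) \<Rightarrow> complex \<Rightarrow> 'a set" where
  "eigenspace T z = {x. T x - z *\<^sub>C x = 0}"

definition infinite_multiplicity :: "('a::complex_inner \<Rightarrow> 'a) \<Rightarrow> complex \<Rightarrow> bool" where
  "infinite_multiplicity T z \<longleftrightarrow> z \<in> point_spectrum T \<and> \<not> cfinite_dim (eigenspace T z)"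

end

(*
A minimiser of |Tx| on the unit sphere of a closed invariant subspace M satisfies T^2 x = m^2 x, and
positivity turns this into T x = m x; hence a maximal orthonormal set of eigenvectors is a basis.

Everything else rests on one remark about (not necessarily invariant) subspaces: if V is an
orthonormal set whose image under T is orthogonal, then |Tv| attains its minimum over V. Applied to
sets of eigenvectors, it makes every set of eigenvalues have a least element. Applied to rotated
pairs of eigenvectors, it shows that for a < b only finitely many basis vectors have eigenvalue
<= a or only finitely many have eigenvalue >= b. Limit points of the spectrum and eigenvalues of
infinite multiplicity are both points with infinitely many basis eigenvalues near them, so there
is at most one such point.
*)

theory Submission
  imports Defs
begin

section \<open>Complex inner product spaces\<close>

lemma cinner_add_right: "cinner x (y + z) = cinner x y + cinner x (z::'a::complex_inner)"
  by (metis cinner_add_left cinner_commute complex_cnj_add)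

lemma cinner_scaleC_right: "cinner x (a *\<^sub>C y) = cnj a * cinner x (y::'a::complex_inner)"
  by (metis cinner_commute cinner_scaleC_left complex_cnj_mult)

lemma cinner_self: "cinner x x = complex_of_real ((norm (x::'a::complex_inner))\<^sup>2)"
proof -
  have "Im (cinner x x) = 0"
    using cinner_commute[of x x] by (simp add: complex_eq_iff)
  then show ?thesis
    by (simp add: complex_eq_iff Re_cinner power2_norm_eq_inner)
qed

text \<open>The class ties the norm to the real inner product only; homogeneity for complex scalars
  follows by pulling \<open>a\<close> out of both arguments of \<open>cinner\<close>, which produces
  the factor \<open>a * cnj a\<close>.\<close>

lemma norm_scaleC: "norm (a *\<^sub>C x) = cmod a * norm (x::'a::complex_inner)"
proof -
  have "complex_of_real ((norm (a *\<^sub>C x))\<^sup>2) = complex_of_real ((cmod a * norm x)\<^sup>2)"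
    unfolding cinner_self[symmetric] cinner_scaleC_left cinner_scaleC_right
    by (simp add: cinner_self power_mult_distrib complex_norm_square mult.commute mult.left_commute
        del: of_real_power)
  then show ?thesis
    by (simp only: of_real_eq_iff) (simp add: power2_eq_iff_nonneg)
qed

text \<open>Multiplying \<open>x\<close> by a unimodular scalar makes the product real and
  nonnegative, which reduces the claim to the real Cauchy-Schwarz inequality.\<close>

lemma norm_cinner_le: "cmod (cinner x y) \<le> norm x * norm (y::'a::complex_inner)"
proof (cases "cinner x y = 0")
  case False
  define a where "a = cnj (cinner x y) / cmod (cinner x y)"
  have "cmod a = 1"
    using False by (simp add: a_def norm_divide)
  have "complex_of_real (cmod (cinner x y)) = a * cinner x y"
    using False by (simp add: a_def complex_norm_square[symmetric] mult.commute power2_eq_square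
        del: of_real_power)
  then have "cmod (cinner x y) = (a *\<^sub>C x) \<bullet> y"
    by (metis Re_complex_of_real Re_cinner cinner_scaleC_left)
  also have "\<dots> \<le> norm (a *\<^sub>C x) * norm y"
    by (rule norm_cauchy_schwarz)
  finally show ?thesis
    using \<open>cmod a = 1\<close> by (simp add: norm_scaleC)
qed simp

lemma bounded_bilinear_cinner:
  "bounded_bilinear (cinner :: 'a::complex_inner \<Rightarrow> 'a \<Rightarrow> complex)"
proof
  show "\<exists>K. \<forall>a b::'a. cmod (cinner a b) \<le> norm a * norm b * K"
    using norm_cinner_le by (metis mult.right_neutral)
qed (simp_all add: cinner_add_left cinner_add_right scaleC_of_real[symmetric]
      cinner_scaleC_left cinner_scaleC_right scaleR_conv_of_real)

interpretation cinner: bounded_bilinear "cinner :: 'a::complex_inner \<Rightarrow> 'a \<Rightarrow> complex"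
  by (rule bounded_bilinear_cinner)

lemma bounded_linear_scaleC: "bounded_linear (\<lambda>x::'a::complex_inner. a *\<^sub>C x)"
proof
  show "\<exists>K. \<forall>x::'a. norm (a *\<^sub>C x) \<le> norm x * K"
    by (auto simp: norm_scaleC mult.commute intro!: exI[of _ "cmod a"])
qed (simp_all add: scaleC_add_right scaleC_of_real[symmetric] scaleC_scaleC mult.commute)

text \<open>Recovers the complex form from the real one, so that a real identity known for both
  \<open>y\<close> and \<open>\<i> *\<^sub>C y\<close> yields a complex identity.\<close>

lemma Im_cinner: "Im (cinner x y) = x \<bullet> (\<i> *\<^sub>C (y::'a::complex_inner))"
  by (simp add: Re_cinner[symmetric] cinner_scaleC_right)

lemma orthogonal_if_cinner_0: "cinner x y = 0 \<Longrightarrow> orthogonal x (y::'a::complex_inner)"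
  by (simp add: orthogonal_def Re_cinner[symmetric])

section \<open>Closed complex spans\<close>

lemma csubspace_closure:
  assumes "csubspace (S :: 'a::complex_inner set)"
  shows "csubspace (closure S)"
proof (rule complex_vector.subspaceI)
  show "0 \<in> closure S"
    using complex_vector.subspace_0[OF assms] closure_subset by blast
  fix x y :: 'a assume x: "x \<in> closure S"
  then obtain f where f: "\<And>n. f n \<in> S" "f \<longlonglongrightarrow> x"
    unfolding closure_sequential by blast
  show "c *\<^sub>C x \<in> closure S" for c
    unfolding closure_sequential
    using f complex_vector.subspace_scale[OF assms, of _ c]
      bounded_linear.tendsto[OF bounded_linear_scaleC]
    by (intro exI[of _ "\<lambda>n. c *\<^sub>C f n"]) blast
  assume "y \<in> closure S"
  then obtain g where g: "\<And>n. g n \<in> S" "g \<longlonglongrightarrow> y"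
    unfolding closure_sequential by blast
  show "x + y \<in> closure S"
    unfolding closure_sequential
    using f g complex_vector.subspace_add[OF assms] tendsto_add
    by (intro exI[of _ "\<lambda>n. f n + g n"]) blast
qed

lemma closure_cspan_minimal:
  assumes "V \<subseteq> S" "csubspace S" "closed S"
  shows "closure (cspan V) \<subseteq> S"
  by (intro closure_minimal complex_vector.span_minimal assms)

text \<open>The vectors satisfying the identity form a closed complex subspace, so it suffices to
  check it on the generators.\<close>

lemma bounded_clinear_cinner_eqI:
  fixes T :: "'a::complex_inner \<Rightarrow> 'b::complex_inner" and S :: "'a \<Rightarrow> 'c::complex_inner"
  assumes T: "bounded_clinear T" and S: "bounded_clinear S"
    and x: "x \<in> closure (cspan V)"
    and V: "\<And>v. v \<in> V \<Longrightarrow> cinner (T v) y = cinner (S v) z"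
  shows "cinner (T x) y = cinner (S x) z"
proof -
  let ?S = "{x. cinner (T x) y = cinner (S x) z}"
  interpret T: bounded_linear T using T by (simp add: bounded_clinear_def)
  interpret S: bounded_linear S using S by (simp add: bounded_clinear_def)
  have "csubspace ?S"
    using T S by (auto intro!: complex_vector.subspaceI
        simp: T.add S.add T.zero S.zero cinner_add_left bounded_clinear_def cinner_scaleC_left cinner.zero_left)
  moreover have "closed ?S"
    by (intro closed_Collect_eq continuous_intros cinner.continuous_on T.continuous_on S.continuous_on)
  ultimately show ?thesis
    using closure_cspan_minimal[of V ?S] V x by blast
qed

lemma bounded_clinear_ident: "bounded_clinear (\<lambda>x::'a::complex_inner. x)"
  by (simp add: bounded_clinear_def bounded_linear_ident)

lemma bounded_clinear_scaleC: "bounded_clinear (\<lambda>x::'a::complex_inner. a *\<^sub>C x)"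
  by (simp add: bounded_clinear_def bounded_linear_scaleC scaleC_scaleC mult.commute)

text \<open>The functional \<open>cinner _ x\<close> vanishes on \<open>V\<close>, hence on its
  closed span, hence at \<open>x\<close> itself.\<close>

lemma eq_0_if_orthogonal_closure_cspan:
  fixes x :: "'a::complex_inner"
  assumes "x \<in> closure (cspan V)" and "\<And>v. v \<in> V \<Longrightarrow> cinner v x = 0"
  shows "x = 0"
proof -
  \<comment> \<open>The zero operator is written as scaling by 0 to fit the extension
    principle.\<close>
  have "cinner x x = cinner (0 *\<^sub>C x) x"
    by (rule bounded_clinear_cinner_eqI[OF bounded_clinear_ident bounded_clinear_scaleC assms(1)])
      (simp add: assms(2) cinner_scaleC_left del: complex_vector.scale_zero_left)
  then show ?thesis
    by (simp add: cinner_self cinner.zero_left)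
qed

section \<open>Orthonormal expansions\<close>

text \<open>By Pythagoras the squared norm of a block of terms is a difference of partial sums of
  squared norms. These are bounded, so the net of finite sums is Cauchy. The sums are unordered,
  hence the index set may be uncountable.\<close>

lemma orthogonal_summable_on:
  fixes f :: "'i \<Rightarrow> 'a::{real_inner,complete_space}"
  assumes orth: "pairwise (\<lambda>i j. orthogonal (f i) (f j)) I"
    and bound: "\<And>F. finite F \<Longrightarrow> F \<subseteq> I \<Longrightarrow> (\<Sum>i\<in>F. (norm (f i))\<^sup>2) \<le> C"
  shows "f summable_on I"
proof -
  let ?n = "\<lambda>F. \<Sum>i\<in>F. (norm (f i))\<^sup>2"
  define A where "A = ?n ` {F. finite F \<and> F \<subseteq> I}"
  have A: "bdd_above A" "A \<noteq> {}"
    unfolding A_def using bound by (auto intro!: bdd_aboveI2)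
  have "cauchy_filter (filtermap (sum f) (finite_subsets_at_top I))"
    unfolding cauchy_filter_metric_filtermap
  proof (intro allI impI)
    fix e :: real assume "e > 0"
    then have "Sup A - (e/2)\<^sup>2 < Sup A" by simp
    \<comment> \<open>Beyond \<open>F\<close> at most \<open>(e/2)^2\<close> of the supremum is
      left, so every larger finite sum is within \<open>e/2\<close> of the sum over
      \<open>F\<close>.\<close>
    then obtain F where F: "finite F" "F \<subseteq> I" "Sup A - (e/2)\<^sup>2 < ?n F"
      unfolding less_cSup_iff[OF A(2,1)] by (auto simp: A_def)
    have close: "dist (sum f F) (sum f G) < e/2" if G: "finite G" "F \<subseteq> G" "G \<subseteq> I" for G
    proof -
      have "?n G \<le> Sup A"
        using G A by (intro cSup_upper) (auto simp: A_def)
      moreover have "?n G = ?n F + ?n (G - F)"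
        using G F by (metis sum.subset_diff add.commute)
      moreover have "(norm (sum f (G - F)))\<^sup>2 = ?n (G - F)"
        using G by (intro norm_sum_Pythagorean pairwise_subset[OF orth]) auto
      ultimately have "(norm (sum f (G - F)))\<^sup>2 < (e/2)\<^sup>2"
        using F by linarith
      then have "norm (sum f (G - F)) < e/2"
        by (rule power2_less_imp_less) (use \<open>e > 0\<close> in simp)
      then show ?thesis
        unfolding dist_norm norm_minus_commute[of "sum f F"] sum_diff[OF G(1,2)] .
    qed
    show "\<exists>P. eventually P (finite_subsets_at_top I) \<and>
        (\<forall>x y. P x \<and> P y \<longrightarrow> dist (sum f x) (sum f y) < e)"
    proof (intro exI conjI allI impI)
      show "\<forall>\<^sub>F G in finite_subsets_at_top I. finite G \<and> F \<subseteq> G \<and> G \<subseteq> I"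
        using F by (auto simp: eventually_finite_subsets_at_top)
      fix x y assume "(finite x \<and> F \<subseteq> x \<and> x \<subseteq> I) \<and> (finite y \<and> F \<subseteq> y \<and> y \<subseteq> I)"
      then show "dist (sum f x) (sum f y) < e"
        by (metis close dist_triangle_half_r)
    qed
  qed
  moreover have "complete (UNIV :: 'a set)"
    by (meson Cauchy_convergent UNIV_I complete_def convergent_def)
  ultimately obtain L where "(sum f \<longlongrightarrow> L) (finite_subsets_at_top I)"
    using complete_uniform[where S = "UNIV :: 'a set"] by (force simp: filterlim_def)
  then show ?thesis
    using summable_on_def has_sum_def by blast
qed

lemma orthonormal_familyD:
  assumes "orthonormal_family \<Lambda> u"
  shows "i \<in> \<Lambda> \<Longrightarrow> cinner (u i) (u i) = 1" "i \<in> \<Lambda> \<Longrightarrow> norm (u i) = 1"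
    "i \<in> \<Lambda> \<Longrightarrow> j \<in> \<Lambda> \<Longrightarrow> i \<noteq> j \<Longrightarrow> cinner (u i) (u j) = 0"
proof -
  show *: "i \<in> \<Lambda> \<Longrightarrow> cinner (u i) (u i) = 1"
    using assms by (auto simp: orthonormal_family_def)
  show "i \<in> \<Lambda> \<Longrightarrow> norm (u i) = 1"
    using * by (simp add: norm_eq_sqrt_inner Re_cinner[symmetric])
  show "i \<in> \<Lambda> \<Longrightarrow> j \<in> \<Lambda> \<Longrightarrow> i \<noteq> j \<Longrightarrow> cinner (u i) (u j) = 0"
    using assms by (auto simp: orthonormal_family_def)
qed

lemma pairwise_orthogonal_scaleC:
  assumes "orthonormal_family \<Lambda> u"
  shows "pairwise (\<lambda>i j. orthogonal (c i *\<^sub>C u i) (c j *\<^sub>C u j)) \<Lambda>"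
  using orthonormal_familyD[OF assms]
  by (auto simp: pairwise_def cinner_scaleC_left cinner_scaleC_right intro!: orthogonal_if_cinner_0)

lemma norm_orthonormal_sum:
  assumes "orthonormal_family \<Lambda> u" "finite F" "F \<subseteq> \<Lambda>"
  shows "(norm (\<Sum>i\<in>F. c i *\<^sub>C u i))\<^sup>2 = (\<Sum>i\<in>F. (cmod (c i))\<^sup>2)"
  using assms pairwise_subset[OF pairwise_orthogonal_scaleC[OF assms(1)] assms(3)]
  by (subst norm_sum_Pythagorean)
    (auto simp: norm_scaleC orthonormal_familyD[OF assms(1)] intro!: sum.cong)

text \<open>For the projection \<open>p\<close> of \<open>x\<close> onto the finite span, both
  \<open>x \<bullet> p\<close> and the squared norm of \<open>p\<close> equal the left-hand side;
  expanding the squared norm of \<open>x - p\<close> then gives the bound.\<close>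

lemma Bessel_inequality:
  assumes "orthonormal_family \<Lambda> u" "finite F" "F \<subseteq> \<Lambda>"
  shows "(\<Sum>i\<in>F. (cmod (cinner x (u i)))\<^sup>2) \<le> (norm x)\<^sup>2"
proof -
  define p where "p = (\<Sum>i\<in>F. cinner x (u i) *\<^sub>C u i)"
  have "cinner x p = (\<Sum>i\<in>F. complex_of_real ((cmod (cinner x (u i)))\<^sup>2))"
    unfolding p_def cinner.sum_right cinner_scaleC_right complex_norm_square
    by (simp add: mult.commute)
  then have "x \<bullet> p = (\<Sum>i\<in>F. (cmod (cinner x (u i)))\<^sup>2)"
    by (simp add: Re_cinner[symmetric])
  moreover have "(norm p)\<^sup>2 = (\<Sum>i\<in>F. (cmod (cinner x (u i)))\<^sup>2)"
    unfolding p_def by (rule norm_orthonormal_sum[OF assms])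
  moreover have "0 \<le> (norm (x - p))\<^sup>2" by simp
  ultimately show ?thesis
    by (simp add: power2_norm_eq_inner inner_diff inner_commute)
qed

text \<open>Bessel's inequality bounds the weighted coefficients. The multiplier 1 gives orthogonal
  projections, and reciprocals of shifted eigenvalues will give resolvents. The absolute value of
  \<open>C\<close> keeps the bound valid for empty \<Lambda>, where \<open>C\<close> may be
  negative.\<close>

lemma orthonormal_multiplier_summable:
  fixes u :: "'i \<Rightarrow> 'a::chilbert_space"
  assumes "orthonormal_family \<Lambda> u" "\<And>l. l \<in> \<Lambda> \<Longrightarrow> cmod (f l) \<le> C"
  shows "(\<lambda>l. (f l * cinner x (u l)) *\<^sub>C u l) summable_on \<Lambda>"
    "norm (\<Sum>\<^sub>\<infinity>l\<in>\<Lambda>. (f l * cinner x (u l)) *\<^sub>C u l) \<le> norm x * \<bar>C\<bar>"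
proof -
  let ?g = "\<lambda>l. (f l * cinner x (u l)) *\<^sub>C u l"
  have bound: "(\<Sum>l\<in>F. (cmod (f l * cinner x (u l)))\<^sup>2) \<le> (norm x * \<bar>C\<bar>)\<^sup>2"
    if F: "finite F" "F \<subseteq> \<Lambda>" for F
  proof -
    have "(\<Sum>l\<in>F. (cmod (f l * cinner x (u l)))\<^sup>2) \<le> (\<Sum>l\<in>F. C\<^sup>2 * (cmod (cinner x (u l)))\<^sup>2)"
      unfolding norm_mult power_mult_distrib using F assms(2)
      by (intro sum_mono mult_right_mono power_mono) auto
    also have "\<dots> \<le> C\<^sup>2 * (norm x)\<^sup>2"
      unfolding sum_distrib_left[symmetric]
      by (intro mult_left_mono Bessel_inequality[OF assms(1) F]) auto
    finally show ?thesis by (simp add: power_mult_distrib mult.commute)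
  qed
  show sm: "?g summable_on \<Lambda>"
  proof (rule orthogonal_summable_on)
    fix F assume F: "finite F" "F \<subseteq> \<Lambda>"
    have "(\<Sum>l\<in>F. (norm (?g l))\<^sup>2) = (\<Sum>l\<in>F. (cmod (f l * cinner x (u l)))\<^sup>2)"
      using F by (intro sum.cong) (auto simp: norm_scaleC orthonormal_familyD[OF assms(1)])
    then show "(\<Sum>l\<in>F. (norm (?g l))\<^sup>2) \<le> (norm x * \<bar>C\<bar>)\<^sup>2"
      using bound[OF F] by simp
  qed (rule pairwise_orthogonal_scaleC[OF assms(1)])
  show "norm (infsum ?g \<Lambda>) \<le> norm x * \<bar>C\<bar>"
  proof (rule tendsto_upperbound)
    show "((\<lambda>F. norm (sum ?g F)) \<longlongrightarrow> norm (infsum ?g \<Lambda>)) (finite_subsets_at_top \<Lambda>)"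
      by (intro tendsto_norm infsum_tendsto sm)
    show "\<forall>\<^sub>F F in finite_subsets_at_top \<Lambda>. norm (sum ?g F) \<le> norm x * \<bar>C\<bar>"
    proof (rule eventually_finite_subsets_at_top_weakI)
      fix F assume F: "finite F" "F \<subseteq> \<Lambda>"
      then have "(norm (sum ?g F))\<^sup>2 \<le> (norm x * \<bar>C\<bar>)\<^sup>2"
        using bound[OF F] norm_orthonormal_sum[OF assms(1) F] by simp
      then show "norm (sum ?g F) \<le> norm x * \<bar>C\<bar>"
        by (rule power2_le_imp_le) simp
    qed
  qed simp
qed

text \<open>The continuous functional \<open>cinner _ (u k)\<close> passes through the sum and kills
  every term but the one at \<open>k\<close>.\<close>

lemma cinner_has_sum_orthonormal:
  assumes "orthonormal_family \<Lambda> u" "((\<lambda>l. c l *\<^sub>C u l) has_sum s) \<Lambda>" "k \<in> \<Lambda>"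
  shows "cinner s (u k) = c k"
proof -
  have "((\<lambda>l. cinner (c l *\<^sub>C u l) (u k)) has_sum cinner s (u k)) \<Lambda>"
    by (rule has_sum_bounded_linear[OF cinner.bounded_linear_left assms(2)])
  moreover have "((\<lambda>l. cinner (c l *\<^sub>C u l) (u k)) has_sum c k) \<Lambda> \<longleftrightarrow> ((\<lambda>_. c k) has_sum c k) {k}"
    using assms orthonormal_familyD[OF assms(1)]
    by (intro has_sum_cong_neutral) (auto simp: cinner_scaleC_left)
  moreover have "((\<lambda>_. c k) has_sum c k) {k}"
    by (simp add: has_sum_finiteI)
  ultimately show ?thesis
    by (blast dest: has_sum_unique)
qed

lemma orthonormal_projection:
  fixes u :: "'i \<Rightarrow> 'a::chilbert_space"
  assumes "orthonormal_family \<Lambda> u"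
  obtains p where "((\<lambda>l. cinner x (u l) *\<^sub>C u l) has_sum p) \<Lambda>"
    "\<And>l. l \<in> \<Lambda> \<Longrightarrow> cinner (x - p) (u l) = 0"
proof -
  obtain p where p: "((\<lambda>l. cinner x (u l) *\<^sub>C u l) has_sum p) \<Lambda>"
    using orthonormal_multiplier_summable(1)[OF assms, of "\<lambda>_. 1" 1 x] by (auto simp: summable_on_def)
  show thesis
    using p cinner_has_sum_orthonormal[OF assms p] by (intro that[of p]) (auto simp: cinner.diff_left)
qed

text \<open>The residual of the projection is orthogonal to a set with dense span, so it is
  0.\<close>

lemma orthonormal_expansion:
  fixes u :: "'i \<Rightarrow> 'a::chilbert_space"
  assumes "orthonormal_basis \<Lambda> u"
  shows "((\<lambda>l. cinner x (u l) *\<^sub>C u l) has_sum x) \<Lambda>"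
proof -
  have u: "orthonormal_family \<Lambda> u" "closure (cspan (u ` \<Lambda>)) = UNIV"
    using assms by (auto simp: orthonormal_basis_def)
  obtain p where p: "((\<lambda>l. cinner x (u l) *\<^sub>C u l) has_sum p) \<Lambda>"
    "\<And>l. l \<in> \<Lambda> \<Longrightarrow> cinner (x - p) (u l) = 0"
    using orthonormal_projection[OF u(1), of x] by blast
  have "x - p = 0"
  proof (rule eq_0_if_orthogonal_closure_cspan)
    show "x - p \<in> closure (cspan (u ` \<Lambda>))" using u by simp
    show "cinner v (x - p) = 0" if "v \<in> u ` \<Lambda>" for v
      using that p(2) by (metis cinner_commute complex_cnj_zero imageE)
  qed
  then show ?thesis using p(1) by simp
qed

text \<open>If only 0 is orthogonal to the family, then each \<open>x\<close> equals its projection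
  and is thus a limit of finite linear combinations.\<close>

lemma orthonormal_basisI:
  fixes u :: "'i \<Rightarrow> 'a::chilbert_space"
  assumes u: "orthonormal_family \<Lambda> u"
    and total: "\<And>x. (\<And>l. l \<in> \<Lambda> \<Longrightarrow> cinner x (u l) = 0) \<Longrightarrow> x = 0"
  shows "orthonormal_basis \<Lambda> u"
proof -
  have "x \<in> closure (cspan (u ` \<Lambda>))" for x
  proof -
    obtain p where p: "((\<lambda>l. cinner x (u l) *\<^sub>C u l) has_sum p) \<Lambda>"
      "\<And>l. l \<in> \<Lambda> \<Longrightarrow> cinner (x - p) (u l) = 0"
      using orthonormal_projection[OF u, of x] by blast
    have "p = x" using total[OF p(2)] by simp
    have "\<forall>\<^sub>F F in finite_subsets_at_top \<Lambda>.
        (\<Sum>l\<in>F. cinner x (u l) *\<^sub>C u l) \<in> closure (cspan (u ` \<Lambda>))"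
      by (intro eventually_finite_subsets_at_top_weakI subsetD[OF closure_subset]
          complex_vector.span_sum complex_vector.span_scale complex_vector.span_base) auto
    then show ?thesis
      using p(1) unfolding has_sum_def \<open>p = x\<close>
      by (intro Lim_in_closed_set[of "closure (cspan (u ` \<Lambda>))"]) auto
  qed
  then show ?thesis
    using u by (auto simp: orthonormal_basis_def)
qed

section \<open>Absolutely minimum attaining operators\<close>

lemma quadratic_nonneg_imp_linear_coeff_0:
  fixes b c :: real
  assumes "\<And>t. 0 \<le> t * b + t\<^sup>2 * c"
  shows "b = 0"
proof (rule ccontr)
  assume "b \<noteq> 0"
  \<comment> \<open>Any \<open>d > 0\<close> exceeding \<open>c\<close> makes the quadratic negative
    at \<open>t = - b / d\<close>, where its value is \<open>b^2 / d^2 * (c - d)\<close>.\<close>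
  define d where "d = \<bar>c\<bar> + 1"
  have d: "d > 0" "c \<le> d - 1" by (auto simp: d_def)
  have "0 \<le> (- b / d) * b + (- b / d)\<^sup>2 * c" by (rule assms)
  also have "\<dots> = b\<^sup>2 / d\<^sup>2 * (c - d)"
    using d by (simp add: field_simps power2_eq_square)
  also have "\<dots> < 0"
    using d \<open>b \<noteq> 0\<close> by (intro mult_pos_neg) auto
  finally show False by simp
qed

text \<open>Since \<open>cadjoint\<close> is a choice that is arbitrary when no adjoint exists, \<open>T = cadjoint T\<close> alone does not
  give symmetry; polarization of the real quadratic form does.\<close>

lemma positive_operator_cinner_commute:
  fixes T :: "'a::complex_inner \<Rightarrow> 'a"
  assumes "positive_operator T"
  shows "cinner (T x) y = cinner x (T y)"
proof -
  interpret T: bounded_linear T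
    using assms by (simp add: positive_operator_def bounded_clinear_def)
  have TC: "T (c *\<^sub>C x) = c *\<^sub>C T x" for c x
    using assms by (simp add: positive_operator_def bounded_clinear_def)
  \<comment> \<open>The defect of symmetry: it vanishes on the diagonal because
    \<open>cinner (T x) x\<close> is real.\<close>
  define B where "B x y = cinner (T x) y - cinner x (T y)" for x y
  have 0: "B x x = 0" for x
  proof -
    have "cinner (T x) x \<in> \<real>"
      using assms by (auto simp: positive_operator_def elim: nonneg_Reals_cases)
    then show ?thesis
      using cinner_commute[of x "T x"] by (simp add: B_def Reals_cnj_iff)
  qed
  have skew: "B x y + B y x = 0" for x y
    using 0[of "x + y"] 0[of x] 0[of y]
    by (simp add: B_def T.add cinner_add_left cinner_add_right algebra_simps)
  have "B x (\<i> *\<^sub>C y) = - \<i> * B x y" "B (\<i> *\<^sub>C y) x = \<i> * B y x"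
    by (simp_all add: B_def TC cinner_scaleC_left cinner_scaleC_right algebra_simps)
  \<comment> \<open>Antisymmetry at \<open>\<i> *\<^sub>C y\<close> makes \<open>B\<close> symmetric
    as well, and a form that is both is 0.\<close>
  then have "- \<i> * B x y + \<i> * B y x = 0"
    using skew[of x "\<i> *\<^sub>C y"] by simp
  then have "B y x = B x y" by (simp add: add_eq_0_iff2)
  then have "B x y = 0"
    using skew[of x y] by simp
  then show ?thesis by (simp add: B_def)
qed

text \<open>The Euler-Lagrange equation of the minimum: with \<open>m = norm (T x0)\<close>, the
  form \<open>norm (T x)^2 - m^2 * norm x^2\<close> is nonnegative on \<open>M\<close> and vanishes
  at \<open>x0\<close>, so its first variation there is 0. This is the weak form on \<open>M\<close>
  of the equation saying that \<open>x0\<close> is an eigenvector of the adjoint of \<open>T\<close>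
  composed with \<open>T\<close>.\<close>

lemma minimizer_stationary:
  fixes T :: "'a::complex_inner \<Rightarrow> 'b::complex_inner"
  assumes T: "bounded_clinear T" and M: "csubspace M"
    and x0: "x0 \<in> M" "norm x0 = 1"
    and min: "\<And>x. x \<in> M \<Longrightarrow> norm x = 1 \<Longrightarrow> norm (T x0) \<le> norm (T x)"
    and y: "y \<in> M"
  shows "cinner (T x0) (T y) = (norm (T x0))\<^sup>2 * cinner x0 y"
proof -
  define m where "m = norm (T x0)"
  interpret T: bounded_linear T using T by (simp add: bounded_clinear_def)
  have TC: "T (c *\<^sub>C x) = c *\<^sub>C T x" for c x
    using T by (simp add: bounded_clinear_def)
  have MR: "r *\<^sub>R x \<in> M" if "x \<in> M" for r x
    using complex_vector.subspace_scale[OF M that, of "complex_of_real r"] by (simp add: scaleC_of_real)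
  have low: "m\<^sup>2 * (norm x)\<^sup>2 \<le> (norm (T x))\<^sup>2" if "x \<in> M" for x
  proof (cases "x = 0")
    case False
    then have "m \<le> norm (T ((1 / norm x) *\<^sub>R x))"
      unfolding m_def using that by (intro min MR) auto
    then have "m * norm x \<le> norm (T x)"
      using False by (simp add: T.scaleR field_simps)
    then have "(m * norm x)\<^sup>2 \<le> (norm (T x))\<^sup>2"
      by (intro power_mono) (auto simp: m_def)
    then show ?thesis by (simp add: power_mult_distrib)
  qed simp
  have real: "T x0 \<bullet> T z = m\<^sup>2 * (x0 \<bullet> z)" if z: "z \<in> M" for z
  proof -
    have "2 * (T x0 \<bullet> T z - m\<^sup>2 * (x0 \<bullet> z)) = 0"
    proof (rule quadratic_nonneg_imp_linear_coeff_0)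
      fix t :: real
      have "m\<^sup>2 * (norm (x0 + t *\<^sub>R z))\<^sup>2 \<le> (norm (T (x0 + t *\<^sub>R z)))\<^sup>2"
        using M x0 z MR by (intro low complex_vector.subspace_add) auto
      then have "m\<^sup>2 * (x0 \<bullet> x0 + t * (2 * (x0 \<bullet> z)) + t\<^sup>2 * (z \<bullet> z))
          \<le> T x0 \<bullet> T x0 + t * (2 * (T x0 \<bullet> T z)) + t\<^sup>2 * (T z \<bullet> T z)"
        unfolding T.add T.scaleR power2_norm_eq_inner
        by (simp add: inner_add_left inner_add_right inner_commute power2_eq_square ac_simps)
      moreover have "x0 \<bullet> x0 = 1" using x0 by (simp add: norm_eq_1)
      moreover have "T x0 \<bullet> T x0 = m\<^sup>2" by (simp add: m_def power2_norm_eq_inner)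
      ultimately show "0 \<le> t * (2 * (T x0 \<bullet> T z - m\<^sup>2 * (x0 \<bullet> z)))
          + t\<^sup>2 * (T z \<bullet> T z - m\<^sup>2 * (z \<bullet> z))"
        by (simp add: algebra_simps)
    qed
    then show ?thesis by simp
  qed
  \<comment> \<open>The direction \<open>y\<close> gives the real part of the claim and
    \<open>\<i> *\<^sub>C y\<close> the imaginary part.\<close>
  have "\<i> *\<^sub>C y \<in> M"
    using M y by (rule complex_vector.subspace_scale)
  then show ?thesis
    using real[OF y] real[of "\<i> *\<^sub>C y"]
    by (simp add: complex_eq_iff Re_cinner Im_cinner TC m_def[symmetric] flip: of_real_power)
qed

lemma absolutely_minimum_attainingE:
  assumes "absolutely_minimum_attaining T" "csubspace M" "closed M" "M \<noteq> {0}"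
  obtains x0 where "x0 \<in> M" "norm x0 = 1"
    "\<And>x. x \<in> M \<Longrightarrow> norm x = 1 \<Longrightarrow> norm (T x0) \<le> norm (T x)"
proof -
  obtain x0 where x0: "x0 \<in> M" "norm x0 = 1" "norm (T x0) = minimum_modulus_on M T"
    using assms by (auto simp: absolutely_minimum_attaining_def minimum_attaining_on_def)
  moreover have "minimum_modulus_on M T \<le> norm (T x)" if "x \<in> M" "norm x = 1" for x
    unfolding minimum_modulus_on_def using that by (intro cInf_lower bdd_belowI[of _ 0]) auto
  ultimately show thesis by (intro that[of x0]) auto
qed

text \<open>A minimiser \<open>x0\<close> on the closed span has a nonzero component along some
  \<open>v\<close>. Orthogonality of the images gives
  \<open>cinner (T x0) (T v) = norm (T v)^2 * cinner x0 v\<close>, while stationarity gives the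
  factor \<open>norm (T x0)^2\<close> instead; hence \<open>v\<close> attains the minimum
  too.\<close>

lemma orthogonal_images_minimum:
  fixes T :: "'a::complex_inner \<Rightarrow> 'b::complex_inner"
  assumes T: "bounded_clinear T" and am: "absolutely_minimum_attaining T"
    and V: "V \<noteq> {}" "\<And>v. v \<in> V \<Longrightarrow> norm v = 1"
      "\<And>v w. v \<in> V \<Longrightarrow> w \<in> V \<Longrightarrow> v \<noteq> w \<Longrightarrow> cinner v w = 0"
      "\<And>v w. v \<in> V \<Longrightarrow> w \<in> V \<Longrightarrow> v \<noteq> w \<Longrightarrow> cinner (T v) (T w) = 0"
  obtains v where "v \<in> V" "\<And>w. w \<in> V \<Longrightarrow> norm (T v) \<le> norm (T w)"
proof -
  define M where "M = closure (cspan V)"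
  have VM: "V \<subseteq> M"
    unfolding M_def using complex_vector.span_superset closure_subset by blast
  obtain x0 where x0: "x0 \<in> M" "norm x0 = 1"
    and min: "\<And>x. x \<in> M \<Longrightarrow> norm x = 1 \<Longrightarrow> norm (T x0) \<le> norm (T x)"
  proof (rule absolutely_minimum_attainingE[OF am])
    show "csubspace M"
      unfolding M_def by (intro csubspace_closure complex_vector.subspace_span)
    show "closed M" by (simp add: M_def)
    show "M \<noteq> {0}" using V(1,2) VM by force
  qed blast
  obtain v where v: "v \<in> V" "cinner v x0 \<noteq> 0"
    using eq_0_if_orthogonal_closure_cspan[of x0 V] x0 by (force simp: M_def)
  let ?d = "\<lambda>y. complex_of_real ((norm (T v))\<^sup>2) *\<^sub>C y"
  \<comment> \<open>On the generators both sides are 0 except at \<open>v\<close>, where both are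
    \<open>norm (T v)^2\<close>.\<close>
  have "cinner (T x0) (T v) = cinner (?d x0) v"
  proof (rule bounded_clinear_cinner_eqI[OF T bounded_clinear_scaleC])
    show "x0 \<in> closure (cspan V)" using x0 by (simp add: M_def)
    show "cinner (T w) (T v) = cinner (?d w) v" if "w \<in> V" for w
      using V(2-4) v(1) that by (cases "w = v") (auto simp: cinner_scaleC_left cinner_self)
  qed
  moreover have "cinner (T x0) (T v) = (norm (T x0))\<^sup>2 * cinner x0 v"
    using v VM by (intro minimizer_stationary[OF T _ x0 min])
      (auto simp: M_def intro!: csubspace_closure complex_vector.subspace_span)
  moreover have "cinner x0 v \<noteq> 0"
    using v by (metis cinner_commute complex_cnj_zero)
  ultimately have "norm (T v) = norm (T x0)"
    by (simp add: cinner_scaleC_left power2_eq_iff_nonneg flip: of_real_power)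
  then show thesis
    using v V(2) VM min by (intro that[of v]) auto
qed

text \<open>A minimiser \<open>x\<close> satisfies \<open>(T + m) (T - m) x = 0\<close> with
  \<open>m\<close> its minimum value, and positivity of \<open>T\<close> forces the factor
  \<open>(T - m) x\<close> to vanish.\<close>

lemma AM_plus_invariant_eigenvector:
  fixes T :: "'a::chilbert_space \<Rightarrow> 'a"
  assumes T: "T \<in> AM_plus" and M: "csubspace M" "closed M" "M \<noteq> {0}"
    and inv: "\<And>x. x \<in> M \<Longrightarrow> T x \<in> M"
  obtains x where "x \<in> M" "norm x = 1" "T x = complex_of_real (norm (T x)) *\<^sub>C x"
proof -
  have pos: "positive_operator T" and am: "absolutely_minimum_attaining T"
    and bl: "bounded_clinear T"
    using T by (auto simp: AM_plus_def positive_operator_def)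
  interpret T: bounded_linear T using bl by (simp add: bounded_clinear_def)
  have TC: "T (c *\<^sub>C x) = c *\<^sub>C T x" for c x
    using bl by (simp add: bounded_clinear_def)
  obtain x where x: "x \<in> M" "norm x = 1"
    and min: "\<And>y. y \<in> M \<Longrightarrow> norm y = 1 \<Longrightarrow> norm (T x) \<le> norm (T y)"
    using absolutely_minimum_attainingE[OF am M] by blast
  define m where "m = complex_of_real (norm (T x))"
  define z where "z = T (T x) - m\<^sup>2 *\<^sub>C x"
  define y where "y = T x - m *\<^sub>C x"
  \<comment> \<open>Invariance makes \<open>z\<close> itself an admissible direction; by symmetry of
    \<open>T\<close>, stationarity in this direction says that \<open>z\<close> is orthogonal to
    itself.\<close>
  have zM: "z \<in> M"
    unfolding z_def using M(1) inv x by (intro complex_vector.subspace_diff complex_vector.subspace_scale) auto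
  have "cinner (T x) (T z) = m\<^sup>2 * cinner x z"
    using minimizer_stationary[OF bl M(1) x min zM] by (simp add: m_def)
  then have "cinner z z = 0"
    by (subst z_def) (simp add: cinner.diff_left cinner_scaleC_left
        positive_operator_cinner_commute[OF pos, of "T x"])
  then have "T (T x) = m\<^sup>2 *\<^sub>C x" by (simp add: cinner_self z_def)
  then have Ty: "T y = (- m) *\<^sub>C y"
    by (simp add: y_def T.diff TC complex_vector.scale_right_diff_distrib scaleC_scaleC power2_eq_square)
  \<comment> \<open>A nonzero \<open>y\<close> would be an eigenvector for \<open>- m\<close>, so
    positivity gives \<open>m = 0\<close>. Then \<open>T x = 0\<close>, and \<open>y\<close> is 0
    after all.\<close>
  have "y = 0"
  proof (rule ccontr)
    assume "y \<noteq> 0"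
    have "cinner (T y) y \<in> \<real>\<^sub>\<ge>\<^sub>0"
      using pos by (simp add: positive_operator_def)
    moreover have "cinner (T y) y = complex_of_real (- norm (T x) * (norm y)\<^sup>2)"
      unfolding Ty cinner_scaleC_left cinner_self by (simp add: m_def)
    ultimately have "0 \<le> - norm (T x) * (norm y)\<^sup>2"
      by (metis nonneg_Reals_of_real_iff)
    then have "norm (T x) = 0"
      using \<open>y \<noteq> 0\<close> by (simp add: mult_le_0_iff)
    then show False
      using \<open>y \<noteq> 0\<close> by (simp add: y_def m_def)
  qed
  then show thesis
    using x by (intro that[of x]) (auto simp: y_def m_def)
qed

text \<open>Zorn's lemma gives a maximal orthonormal set of eigenvectors. Symmetry makes its
  orthogonal complement invariant, so a nonzero complement would contain one more eigenvector.
  Writing the eigenvalue as \<open>norm (T x)\<close> builds in its nonnegativity.\<close>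

lemma AM_plus_eigenbasis:
  fixes T :: "'a::chilbert_space \<Rightarrow> 'a"
  assumes T: "T \<in> AM_plus"
  obtains E where "orthonormal_basis E (\<lambda>x. x)"
    "\<And>x. x \<in> E \<Longrightarrow> T x = complex_of_real (norm (T x)) *\<^sub>C x"
proof -
  have pos: "positive_operator T" using T by (simp add: AM_plus_def)
  define \<E> where "\<E> = {E. orthonormal_family E (\<lambda>x. x) \<and>
    (\<forall>x\<in>E. T x = complex_of_real (norm (T x)) *\<^sub>C x)}"
  have "\<Union>C \<in> \<E>" if C: "subset.chain \<E> C" for C
  proof -
    have sub: "E \<in> \<E>" if "E \<in> C" for E
      using C that by (auto simp: subset.chain_def)
    have "cinner x y = (if x = y then 1 else 0)" if xy: "x \<in> E" "E \<in> C" "y \<in> F" "F \<in> C" for x y E F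
    proof -
      \<comment> \<open>Any two vectors of the union lie in a common member of the chain.\<close>
      have "E \<subseteq> F \<or> F \<subseteq> E"
        using C xy by (auto simp: subset.chain_def)
      then show ?thesis
        using sub[OF xy(2)] sub[OF xy(4)] xy(1,3) unfolding \<E>_def orthonormal_family_def by blast
    qed
    then show ?thesis
      using sub by (auto simp: \<E>_def orthonormal_family_def)
  qed
  then obtain E where E: "E \<in> \<E>" and max: "\<And>F. F \<in> \<E> \<Longrightarrow> E \<subseteq> F \<Longrightarrow> F = E"
    using subset_Zorn'[of \<E>] by blast
  define M where "M = {y. \<forall>x\<in>E. cinner y x = 0}"
  have "M = {0}"
  proof (rule ccontr)
    assume "M \<noteq> {0}"
    have "csubspace M"
      by (auto simp: M_def cinner.zero_left cinner_add_left cinner_scaleC_left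
          intro!: complex_vector.subspaceI)
    moreover have "M = (\<Inter>x\<in>E. {y. cinner y x = 0})" by (auto simp: M_def)
    then have "closed M"
      by (auto intro!: closed_Collect_eq continuous_intros cinner.continuous_on)
    moreover have "T y \<in> M" if "y \<in> M" for y
      unfolding M_def
    proof (intro CollectI ballI)
      fix x assume x: "x \<in> E"
      then have "T x = complex_of_real (norm (T x)) *\<^sub>C x"
        using E by (simp add: \<E>_def)
      then have "cinner y (T x) = complex_of_real (norm (T x)) * cinner y x"
        by (metis cinner_scaleC_right complex_cnj_complex_of_real)
      then show "cinner (T y) x = 0"
        using that x by (simp add: M_def positive_operator_cinner_commute[OF pos])
    qed
    ultimately obtain v where v: "v \<in> M" "norm v = 1" "T v = complex_of_real (norm (T v)) *\<^sub>C v"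
      using AM_plus_invariant_eigenvector[OF T _ _ \<open>M \<noteq> {0}\<close>] by blast
    have v0: "cinner v x = 0" "cinner x v = 0" if "x \<in> E" for x
      using that v(1) cinner_commute[of x v] by (auto simp: M_def)
    moreover have "cinner v v = 1" using v by (simp add: cinner_self)
    ultimately have "insert v E \<in> \<E>"
      using E v(3) by (auto simp: \<E>_def orthonormal_family_def)
    then have "v \<in> E" using max by blast
    then show False using v0 \<open>cinner v v = 1\<close> by force
  qed
  then have "orthonormal_basis E (\<lambda>x. x)"
    using E by (intro orthonormal_basisI) (auto simp: \<E>_def M_def)
  then show thesis
    using E by (intro that[of E]) (auto simp: \<E>_def)
qed

section \<open>Diagonal operators\<close>

lemma bounded_clinear_multiplier:
  fixes u :: "'i \<Rightarrow> 'a::chilbert_space"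
  assumes u: "orthonormal_family \<Lambda> u" and f: "\<And>l. l \<in> \<Lambda> \<Longrightarrow> cmod (f l) \<le> C"
  shows "bounded_clinear (\<lambda>x. \<Sum>\<^sub>\<infinity>l\<in>\<Lambda>. (f l * cinner x (u l)) *\<^sub>C u l)"
proof -
  let ?S = "\<lambda>x. \<Sum>\<^sub>\<infinity>l\<in>\<Lambda>. (f l * cinner x (u l)) *\<^sub>C u l"
  note sm = orthonormal_multiplier_summable(1)[where f = f, OF u f]
  have add: "?S (x + y) = ?S x + ?S y" for x y
    by (simp add: cinner_add_left scaleC_add_left distrib_left infsum_add[OF sm sm])
  have scale: "?S (c *\<^sub>C x) = c *\<^sub>C ?S x" for c x
  proof (rule infsumI)
    have "((\<lambda>l. c *\<^sub>C ((f l * cinner x (u l)) *\<^sub>C u l)) has_sum c *\<^sub>C ?S x) \<Lambda>"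
      using sm by (intro has_sum_bounded_linear[OF bounded_linear_scaleC] has_sum_infsum)
    then show "((\<lambda>l. (f l * cinner (c *\<^sub>C x) (u l)) *\<^sub>C u l) has_sum c *\<^sub>C ?S x) \<Lambda>"
      by (simp add: scaleC_scaleC cinner_scaleC_left mult.left_commute)
  qed
  have "bounded_linear ?S"
  proof (rule bounded_linear_intro)
    show "?S (r *\<^sub>R x) = r *\<^sub>R ?S x" for r x
      using scale[of "complex_of_real r" x] by (simp only: scaleC_of_real)
    show "norm (?S x) \<le> norm x * \<bar>C\<bar>" for x
      by (rule orthonormal_multiplier_summable(2)[OF u f])
  qed (rule add)
  then show ?thesis
    using scale by (simp add: bounded_clinear_def)
qed

text \<open>Collects what follows from diagonalisation with real eigenvalues alone; the minimum
  attaining property enters in the locale that extends this one.\<close>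

locale diagonal_operator =
  fixes T :: "'a::chilbert_space \<Rightarrow> 'a" and \<Lambda> :: "'i set" and u :: "'i \<Rightarrow> 'a" and \<alpha> :: "'i \<Rightarrow> real"
  assumes bounded_clinear: "bounded_clinear T"
    and orthonormal_basis: "orthonormal_basis \<Lambda> u"
    and eigenvalue: "l \<in> \<Lambda> \<Longrightarrow> T (u l) = complex_of_real (\<alpha> l) *\<^sub>C u l"
begin

sublocale T: bounded_linear T
  using bounded_clinear by (simp add: bounded_clinear_def)

lemma scaleC: "T (c *\<^sub>C x) = c *\<^sub>C T x"
  using bounded_clinear by (simp add: bounded_clinear_def)

lemma orthonormal: "orthonormal_family \<Lambda> u"
  using orthonormal_basis by (simp add: orthonormal_basis_def)

lemmas u_simps = orthonormal_familyD[OF orthonormal]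

lemma has_sum_operator:
  "((\<lambda>l. (complex_of_real (\<alpha> l) * cinner x (u l)) *\<^sub>C u l) has_sum T x) \<Lambda>"
proof -
  have "((\<lambda>l. T (cinner x (u l) *\<^sub>C u l)) has_sum T x) \<Lambda>"
    by (rule has_sum_bounded_linear[OF T.bounded_linear_axioms orthonormal_expansion[OF orthonormal_basis]])
  then show ?thesis
    by (rule has_sum_cong[THEN iffD1, rotated]) (simp add: scaleC eigenvalue scaleC_scaleC mult.commute)
qed

lemma cinner_operator: "l \<in> \<Lambda> \<Longrightarrow> cinner (T x) (u l) = complex_of_real (\<alpha> l) * cinner x (u l)"
  by (rule cinner_has_sum_orthonormal[OF orthonormal has_sum_operator])

text \<open>Off the closure the reciprocals of the shifted eigenvalues are bounded and define the
  inverse as a multiplier. On the closure \<open>T - z\<close> shrinks some unit eigenvectors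
  arbitrarily, which contradicts a bounded inverse.\<close>

lemma spectrum_eq: "spectrum T = closure ((\<lambda>l. complex_of_real (\<alpha> l)) ` \<Lambda>)"
proof (intro set_eqI iffI)
  fix z assume z: "z \<in> spectrum T"
  show "z \<in> closure ((\<lambda>l. complex_of_real (\<alpha> l)) ` \<Lambda>)"
  proof (rule ccontr)
    assume "z \<notin> closure ((\<lambda>l. complex_of_real (\<alpha> l)) ` \<Lambda>)"
    then obtain d where d: "d > 0" "\<And>l. l \<in> \<Lambda> \<Longrightarrow> d \<le> cmod (complex_of_real (\<alpha> l) - z)"
      by (auto simp: closure_approachable dist_norm not_less)
    define f where "f l = 1 / (complex_of_real (\<alpha> l) - z)" for l
    have f: "cmod (f l) \<le> 1 / d" if "l \<in> \<Lambda>" for l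
      unfolding f_def norm_divide norm_one using d that by (intro frac_le) auto
    have f_mult: "(complex_of_real (\<alpha> l) - z) * f l = 1" if "l \<in> \<Lambda>" for l
      using d that by (force simp: f_def)
    define S where "S x = (\<Sum>\<^sub>\<infinity>l\<in>\<Lambda>. (f l * cinner x (u l)) *\<^sub>C u l)" for x
    have S: "((\<lambda>l. (f l * cinner x (u l)) *\<^sub>C u l) has_sum S x) \<Lambda>" for x
      unfolding S_def using orthonormal_multiplier_summable(1)[OF orthonormal f]
      by (rule has_sum_infsum)
    have "bounded_clinear S"
      unfolding S_def by (rule bounded_clinear_multiplier[OF orthonormal f])
    moreover have "S (T x - z *\<^sub>C x) = x" for x
    proof (rule has_sum_unique[OF _ orthonormal_expansion[OF orthonormal_basis]])
      have "f l * cinner (T x - z *\<^sub>C x) (u l) = cinner x (u l)" if "l \<in> \<Lambda>" for l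
        using f_mult[OF that]
        by (simp add: cinner.diff_left cinner_operator[OF that] cinner_scaleC_left
            left_diff_distrib[symmetric]) (simp add: mult.assoc[symmetric] mult.commute)
      then show "((\<lambda>l. cinner x (u l) *\<^sub>C u l) has_sum S (T x - z *\<^sub>C x)) \<Lambda>"
        using S[of "T x - z *\<^sub>C x"] by (simp cong: has_sum_cong)
    qed
    moreover have "T (S x) - z *\<^sub>C S x = x" for x
    proof -
      have "cinner (T (S x) - z *\<^sub>C S x) (u l) = cinner x (u l)" if "l \<in> \<Lambda>" for l
        using f_mult[OF that]
        by (simp add: cinner.diff_left cinner_operator[OF that] cinner_scaleC_left
            left_diff_distrib[symmetric] cinner_has_sum_orthonormal[OF orthonormal S that] mult.assoc[symmetric])
      then have "((\<lambda>l. cinner x (u l) *\<^sub>C u l) has_sum (T (S x) - z *\<^sub>C S x)) \<Lambda>"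
        using orthonormal_expansion[OF orthonormal_basis, of "T (S x) - z *\<^sub>C S x"]
        by (simp cong: has_sum_cong)
      then show ?thesis
        by (rule has_sum_unique[OF _ orthonormal_expansion[OF orthonormal_basis]])
    qed
    ultimately show False
      using z by (auto simp: spectrum_def)
  qed
next
  fix z assume z: "z \<in> closure ((\<lambda>l. complex_of_real (\<alpha> l)) ` \<Lambda>)"
  show "z \<in> spectrum T"
    unfolding spectrum_def
  proof (intro CollectI notI, elim exE conjE)
    fix S assume S: "bounded_clinear S" "\<forall>x. S (T x - z *\<^sub>C x) = x"
    then have "bounded_linear S" by (simp add: bounded_clinear_def)
    then obtain K where K: "K > 0" "\<And>x. norm (S x) \<le> norm x * K"
      using bounded_linear.pos_bounded by blast
    \<comment> \<open>An eigenvalue closer to \<open>z\<close> than \<open>1 / K\<close> sends a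
      unit vector to one of norm below \<open>1 / K\<close>, too short for \<open>S\<close> to
      restore norm 1.\<close>
    then obtain l where l: "l \<in> \<Lambda>" "cmod (complex_of_real (\<alpha> l) - z) < 1 / K"
      using z[unfolded closure_approachable, rule_format, of "1 / K"] by (auto simp: dist_norm)
    have "1 = norm (S (T (u l) - z *\<^sub>C u l))"
      using S l u_simps by simp
    also have "\<dots> \<le> norm ((complex_of_real (\<alpha> l) - z) *\<^sub>C u l) * K"
      using K(2) l(1) by (simp add: eigenvalue complex_vector.scale_left_diff_distrib)
    also have "\<dots> < 1"
      unfolding norm_scaleC using l K(1) by (simp add: u_simps field_simps)
    finally show False by simp
  qed
qed

lemma eigenvector_coefficient:
  assumes "T x = z *\<^sub>C x" "l \<in> \<Lambda>" "cinner x (u l) \<noteq> 0"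
  shows "z = complex_of_real (\<alpha> l)"
  using cinner_operator[OF assms(2), of x] assms by (simp add: cinner_scaleC_left)

text \<open>A nonzero eigenvector has a nonzero coefficient in the basis, and that coefficient
  determines its eigenvalue.\<close>

lemma point_spectrum_subset: "point_spectrum T \<subseteq> (\<lambda>l. complex_of_real (\<alpha> l)) ` \<Lambda>"
proof
  fix z assume "z \<in> point_spectrum T"
  then obtain x y where xy: "T x - z *\<^sub>C x = T y - z *\<^sub>C y" "x \<noteq> y"
    by (auto simp: point_spectrum_def inj_def)
  then have ev: "T (x - y) = z *\<^sub>C (x - y)"
    by (simp add: T.diff complex_vector.scale_right_diff_distrib algebra_simps)
  have "\<exists>l\<in>\<Lambda>. cinner (x - y) (u l) \<noteq> 0"
  proof (rule ccontr)
    assume "\<not> ?thesis"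
    then have "((\<lambda>_. 0) has_sum (x - y)) \<Lambda>"
      using orthonormal_expansion[OF orthonormal_basis, of "x - y"] by (simp cong: has_sum_cong)
    then have "x - y = 0" using has_sum_0_simp has_sum_unique by blast
    then show False using xy by simp
  qed
  then show "z \<in> (\<lambda>l. complex_of_real (\<alpha> l)) ` \<Lambda>"
    using eigenvector_coefficient[OF ev] by blast
qed

text \<open>If only finitely many basis vectors had eigenvalue \<open>r\<close>, they would span the
  whole eigenspace, since eigenvectors have no other nonzero coefficients.\<close>

lemma infinite_multiplicityE:
  assumes "infinite_multiplicity T z"
  obtains r where "z = complex_of_real r" "infinite {l \<in> \<Lambda>. \<alpha> l = r}"
proof -
  obtain r where r: "z = complex_of_real r"
    using assms point_spectrum_subset by (auto simp: infinite_multiplicity_def)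
  let ?F = "{l \<in> \<Lambda>. \<alpha> l = r}"
  have "infinite ?F"
  proof
    assume fin: "finite ?F"
    have "eigenspace T z \<subseteq> cspan (u ` ?F)"
    proof
      fix x assume "x \<in> eigenspace T z"
      then have x: "T x = z *\<^sub>C x" by (simp add: eigenspace_def)
      have "((\<lambda>l. cinner x (u l) *\<^sub>C u l) has_sum x) \<Lambda> \<longleftrightarrow>
          ((\<lambda>l. cinner x (u l) *\<^sub>C u l) has_sum x) ?F"
        using eigenvector_coefficient[OF x] by (intro has_sum_cong_neutral) (auto simp: r)
      then have "x = (\<Sum>l\<in>?F. cinner x (u l) *\<^sub>C u l)"
        using fin orthonormal_expansion[OF orthonormal_basis, of x]
        by (metis has_sum_finite has_sum_unique)
      also have "\<dots> \<in> cspan (u ` ?F)"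
        by (intro complex_vector.span_sum complex_vector.span_scale complex_vector.span_base) auto
      finally show "x \<in> cspan (u ` ?F)" .
    qed
    moreover have "cspan (u ` ?F) \<subseteq> eigenspace T z"
    proof (rule complex_vector.span_minimal)
      show "csubspace (eigenspace T z)"
        by (auto simp: eigenspace_def T.add scaleC scaleC_add_right scaleC_scaleC mult.commute T.zero
            intro!: complex_vector.subspaceI)
    qed (auto simp: eigenspace_def eigenvalue r)
    ultimately show False
      using assms fin by (auto simp: infinite_multiplicity_def cfinite_dim_def)
  qed
  then show thesis using that r by blast
qed

text \<open>The coefficients are arbitrary so that one computation covers the rotated pairs as well
  as their images under \<open>T\<close>.\<close>

lemma orthogonal_pairs:
  assumes "inj e" "inj f" "range e \<subseteq> \<Lambda>" "range f \<subseteq> \<Lambda>" "range e \<inter> range f = {}"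
  shows "cinner (complex_of_real (c n) *\<^sub>C u (e n) + complex_of_real (d n) *\<^sub>C u (f n))
      (complex_of_real (c m) *\<^sub>C u (e m) + complex_of_real (d m) *\<^sub>C u (f m)) =
    (if n = m then complex_of_real ((c n)\<^sup>2 + (d n)\<^sup>2) else 0)"
proof -
  have \<Lambda>: "e i \<in> \<Lambda>" "f i \<in> \<Lambda>" "e i \<noteq> f j" "f j \<noteq> e i" for i j
    using assms(3-5) by force+
  have "cinner (u (e n)) (u (e m)) = (if n = m then 1 else 0)"
    "cinner (u (f n)) (u (f m)) = (if n = m then 1 else 0)"
    "cinner (u (e n)) (u (f m)) = 0" "cinner (u (f n)) (u (e m)) = 0"
    using \<Lambda> assms(1,2) by (auto simp: u_simps inj_eq)
  then show ?thesis
    by (simp add: cinner_add_left cinner_add_right cinner_scaleC_left cinner_scaleC_right power2_eq_square)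
qed

end

text \<open>A set of reals well-ordered by the usual order: every element has a rational between
  itself and all larger elements, and these rationals are distinct.\<close>

lemma countable_if_minima:
  fixes A :: "real set"
  assumes "\<And>B. B \<subseteq> A \<Longrightarrow> B \<noteq> {} \<Longrightarrow> \<exists>m\<in>B. \<forall>x\<in>B. m \<le> x"
  shows "countable A"
proof -
  have "\<exists>q. a < of_rat q \<and> (\<forall>x\<in>A. a < x \<longrightarrow> of_rat q < x)" for a :: real
  proof (cases "{x \<in> A. a < x} = {}")
    case True
    then show ?thesis
      using of_rat_dense[of a "a + 1"] by auto
  next
    case False
    then obtain m where "m \<in> A" "a < m" "\<forall>x\<in>A. a < x \<longrightarrow> m \<le> x"
      using assms[of "{x \<in> A. a < x}"] by auto
    then show ?thesis
      using of_rat_dense[of a m] by (meson order_less_le_trans)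
  qed
  then obtain q where q: "\<And>a. a < of_rat (q a)" "\<And>a x. x \<in> A \<Longrightarrow> a < x \<Longrightarrow> of_rat (q a) < x"
    by metis
  \<comment> \<open>For \<open>a < b\<close> in \<open>A\<close>, the rational chosen for
    \<open>a\<close> is below \<open>b\<close> and the one chosen for \<open>b\<close> is above
    it.\<close>
  have "inj_on q A"
    by (rule linorder_inj_onI') (metis q less_asym order_less_irrefl less_trans)
  then show ?thesis
    using countable_image_inj_on countableI_type by blast
qed

section \<open>Eigenvalues of diagonal absolutely minimum attaining operators\<close>

locale AM_diagonal = diagonal_operator +
  assumes nonneg: "l \<in> \<Lambda> \<Longrightarrow> 0 \<le> \<alpha> l"
    and absolutely_minimum_attaining: "absolutely_minimum_attaining T"
begin

lemma norm_eigenvalue: "l \<in> \<Lambda> \<Longrightarrow> norm (T (u l)) = \<alpha> l"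
  by (simp add: eigenvalue norm_scaleC u_simps nonneg)

text \<open>Eigenvectors have orthogonal images, and nonnegativity identifies the norms of these
  images with the eigenvalues.\<close>

lemma eigenvalue_minimum:
  assumes "\<Gamma> \<subseteq> \<Lambda>" "\<Gamma> \<noteq> {}"
  shows "\<exists>g\<in>\<Gamma>. \<forall>l\<in>\<Gamma>. \<alpha> g \<le> \<alpha> l"
proof -
  obtain v where "v \<in> u ` \<Gamma>" "\<And>w. w \<in> u ` \<Gamma> \<Longrightarrow> norm (T v) \<le> norm (T w)"
  proof (rule orthogonal_images_minimum[OF bounded_clinear absolutely_minimum_attaining, of "u ` \<Gamma>"])
    fix v w assume "v \<in> u ` \<Gamma>" "w \<in> u ` \<Gamma>" "v \<noteq> w"
    then obtain i j where ij: "i \<in> \<Lambda>" "j \<in> \<Lambda>" "i \<noteq> j" "v = u i" "w = u j"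
      using assms by blast
    then show "cinner v w = 0" "cinner (T v) (T w) = 0"
      by (simp_all add: u_simps eigenvalue cinner_scaleC_left cinner_scaleC_right)
  qed (use assms u_simps in auto)
  then show ?thesis
    using assms(1) norm_eigenvalue by (metis (no_types, lifting) image_iff imageI subsetD)
qed

text \<open>If both sets were infinite, pairing eigenvectors \<open>u (e n)\<close> with eigenvalue at most \<open>a\<close> and
  \<open>u (f n)\<close> with eigenvalue at least \<open>b\<close> and rotating in their span would give an orthonormal
  sequence \<open>v n\<close> for which the norms of the orthogonal vectors \<open>T (v n)\<close> strictly decrease to \<open>a\<close>.\<close>

lemma finite_below_or_above:
  assumes "a < b"
  shows "finite {l \<in> \<Lambda>. \<alpha> l \<le> a} \<or> finite {l \<in> \<Lambda>. b \<le> \<alpha> l}"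
proof (rule ccontr)
  assume "\<not> ?thesis"
  then obtain e f :: "nat \<Rightarrow> 'b" where ef: "inj e" "range e \<subseteq> {l \<in> \<Lambda>. \<alpha> l \<le> a}"
    "inj f" "range f \<subseteq> {l \<in> \<Lambda>. b \<le> \<alpha> l}"
    by (meson infinite_countable_subset)
  then have e: "e n \<in> \<Lambda>" "\<alpha> (e n) \<le> a" "0 \<le> \<alpha> (e n)" and f: "f n \<in> \<Lambda>" "b \<le> \<alpha> (f n)" for n
    using nonneg by auto
  \<comment> \<open>The target norms start at the midpoint of \<open>a\<close> and \<open>b\<close>;
    the 2 in the denominator keeps \<open>g 0\<close> below \<open>b\<close>.\<close>
  define g where "g n = a + (b - a) / (real n + 2)" for n
  have g: "a < g n" "g n < b" "g (Suc n) < g n" for n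
    using assms by (auto simp: g_def field_simps intro!: divide_strict_left_mono add_less_le_mono mult_right_mono)
  have sq: "(\<alpha> (e n))\<^sup>2 < (g n)\<^sup>2" "(g n)\<^sup>2 < (\<alpha> (f n))\<^sup>2" for n
    using e[of n] f[of n] g[of n] by (auto intro!: power_strict_mono)
  \<comment> \<open>The weight for which the convex combination of the two squared eigenvalues is
    \<open>(g n)^2\<close>; its square roots are the rotation coefficients.\<close>
  define t where "t n = ((g n)\<^sup>2 - (\<alpha> (e n))\<^sup>2) / ((\<alpha> (f n))\<^sup>2 - (\<alpha> (e n))\<^sup>2)" for n
  have t: "0 \<le> t n" "t n \<le> 1" for n
    using sq[of n] by (auto simp: t_def divide_simps)
  have "t n * ((\<alpha> (f n))\<^sup>2 - (\<alpha> (e n))\<^sup>2) = (g n)\<^sup>2 - (\<alpha> (e n))\<^sup>2" for n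
    using sq[of n] by (simp add: t_def)
  then have t_eq: "(1 - t n) * (\<alpha> (e n))\<^sup>2 + t n * (\<alpha> (f n))\<^sup>2 = (g n)\<^sup>2" for n
    by (simp add: algebra_simps)
  define v where "v n = complex_of_real (sqrt (1 - t n)) *\<^sub>C u (e n)
    + complex_of_real (sqrt (t n)) *\<^sub>C u (f n)" for n
  have Tv: "T (v n) = complex_of_real (sqrt (1 - t n) * \<alpha> (e n)) *\<^sub>C u (e n)
    + complex_of_real (sqrt (t n) * \<alpha> (f n)) *\<^sub>C u (f n)" for n
    by (simp add: v_def T.add scaleC eigenvalue e f scaleC_scaleC)
  have "e n \<noteq> f m" for n m
    using e(2)[of n] f(2)[of m] assms by auto
  then have "range e \<inter> range f = {}" by auto
  then have pairs: "cinner (complex_of_real (c n) *\<^sub>C u (e n) + complex_of_real (d n) *\<^sub>C u (f n))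
      (complex_of_real (c m) *\<^sub>C u (e m) + complex_of_real (d m) *\<^sub>C u (f m)) =
    (if n = m then complex_of_real ((c n)\<^sup>2 + (d n)\<^sup>2) else 0)" for c d n m
    using ef by (intro orthogonal_pairs) auto
  have v: "cinner (v n) (v m) = (if n = m then 1 else 0)" for n m
    using pairs[of "\<lambda>n. sqrt (1 - t n)" n "\<lambda>n. sqrt (t n)" m]
    by (simp add: v_def t del: of_real_power of_real_add)
  have cinner_Tv: "cinner (T (v n)) (T (v m)) = (if n = m then complex_of_real ((g n)\<^sup>2) else 0)" for n m
    using pairs[of "\<lambda>n. sqrt (1 - t n) * \<alpha> (e n)" n "\<lambda>n. sqrt (t n) * \<alpha> (f n)" m]
    unfolding Tv by (simp add: power_mult_distrib t t_eq del: of_real_mult of_real_power of_real_add)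
  have norm_Tv: "norm (T (v n)) = g n" for n
  proof -
    have "(norm (T (v n)))\<^sup>2 = (g n)\<^sup>2"
      using cinner_Tv[of n n] cinner_self[of "T (v n)"] by (metis of_real_eq_iff)
    moreover have "0 \<le> g n" using g(1)[of n] e(2,3)[of n] by linarith
    ultimately show ?thesis by (simp add: power2_eq_iff_nonneg)
  qed
  obtain w where w: "w \<in> range v" "\<And>x. x \<in> range v \<Longrightarrow> norm (T w) \<le> norm (T x)"
  proof (rule orthogonal_images_minimum[OF bounded_clinear absolutely_minimum_attaining, of "range v"])
    show "norm x = 1" if "x \<in> range v" for x
      using that v by (auto simp: norm_eq_sqrt_inner Re_cinner[symmetric])
  qed (auto simp: v cinner_Tv)
  then obtain n where "w = v n" by blast
  \<comment> \<open>No \<open>v n\<close> can be a minimiser, because the next vector has an image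
    of smaller norm.\<close>
  then have "g n \<le> g (Suc n)"
    using w(2)[of "v (Suc n)"] by (simp add: norm_Tv)
  then show False using g(3)[of n] by simp
qed

lemma infinite_near_unique:
  assumes "\<And>e. e > 0 \<Longrightarrow> infinite {l \<in> \<Lambda>. \<bar>\<alpha> l - r\<bar> < e}"
    and "\<And>e. e > 0 \<Longrightarrow> infinite {l \<in> \<Lambda>. \<bar>\<alpha> l - s\<bar> < e}"
  shows "r = s"
proof -
  have False if rs: "r < s" "\<And>e. e > 0 \<Longrightarrow> infinite {l \<in> \<Lambda>. \<bar>\<alpha> l - r\<bar> < e}"
    "\<And>e. e > 0 \<Longrightarrow> infinite {l \<in> \<Lambda>. \<bar>\<alpha> l - s\<bar> < e}" for r s
  proof -
    \<comment> \<open>A third of the distance leaves a gap between \<open>r + d\<close> and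
      \<open>s - d\<close>, with infinitely many basis indices on either side.\<close>
    define d where "d = (s - r) / 3"
    have d: "d > 0" using rs by (simp add: d_def)
    have "{l \<in> \<Lambda>. \<bar>\<alpha> l - r\<bar> < d} \<subseteq> {l \<in> \<Lambda>. \<alpha> l \<le> r + d}"
      "{l \<in> \<Lambda>. \<bar>\<alpha> l - s\<bar> < d} \<subseteq> {l \<in> \<Lambda>. s - d \<le> \<alpha> l}" by auto
    then have "infinite {l \<in> \<Lambda>. \<alpha> l \<le> r + d}" "infinite {l \<in> \<Lambda>. s - d \<le> \<alpha> l}"
      using rs(2,3)[OF d] finite_subset by blast+
    moreover have "r + d < s - d" using rs(1) by (simp add: d_def field_simps)
    ultimately show False using finite_below_or_above by blast
  qed
  from this[of r s] this[of s r] show ?thesis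
    using assms by (cases r s rule: linorder_cases) blast+
qed

section \<open>Limit points of the spectrum\<close>

lemma spectrum_real: "z \<in> spectrum T \<Longrightarrow> \<exists>r. z = complex_of_real r"
proof -
  have "spectrum T \<subseteq> \<real>"
    unfolding spectrum_eq by (intro closure_minimal closed_complex_Reals) auto
  then show "\<exists>r. z = complex_of_real r" if "z \<in> spectrum T"
    using that by (auto elim: Reals_cases)
qed

lemma of_real_in_spectrum: "complex_of_real r \<in> spectrum T \<longleftrightarrow> (\<forall>e>0. \<exists>l\<in>\<Lambda>. \<bar>\<alpha> l - r\<bar> < e)"
  by (simp add: spectrum_eq closure_approachable dist_norm flip: of_real_diff)

text \<open>A set and its closure have the same limit points, so eigenvalues themselves accumulate
  at the point.\<close>

lemma limit_pointE:
  assumes "z islimpt spectrum T"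
  obtains r where "z = complex_of_real r" "\<And>e. e > 0 \<Longrightarrow> \<exists>l\<in>\<Lambda>. \<alpha> l \<noteq> r \<and> \<bar>\<alpha> l - r\<bar> < e"
proof -
  have lim: "z islimpt ((\<lambda>l. complex_of_real (\<alpha> l)) ` \<Lambda>)"
    using assms by (simp add: spectrum_eq limpt_of_closure)
  moreover have "z \<in> spectrum T"
    using assms closed_limpt spectrum_eq by (metis closed_closure)
  then obtain r where r: "z = complex_of_real r"
    using spectrum_real by blast
  ultimately have "\<exists>l\<in>\<Lambda>. \<alpha> l \<noteq> r \<and> \<bar>\<alpha> l - r\<bar> < e" if "e > 0" for e
    using that by (force simp: islimpt_approachable dist_norm simp flip: of_real_diff)
  then show thesis using that r by blast
qed

text \<open>The eigenvalues above \<open>r\<close> have a least element if there are any; its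
  distance to \<open>r\<close> is the gap.\<close>

lemma gap_above: "\<exists>d>0. \<forall>l\<in>\<Lambda>. r < \<alpha> l \<longrightarrow> r + d \<le> \<alpha> l"
proof (cases "{l \<in> \<Lambda>. r < \<alpha> l} = {}")
  case True
  then show ?thesis by (auto intro: exI[of _ 1])
next
  case False
  then obtain g where "g \<in> \<Lambda>" "r < \<alpha> g" "\<forall>l\<in>\<Lambda>. r < \<alpha> l \<longrightarrow> \<alpha> g \<le> \<alpha> l"
    using eigenvalue_minimum[of "{l \<in> \<Lambda>. r < \<alpha> l}"] by auto
  then show ?thesis by (auto intro: exI[of _ "\<alpha> g - r"])
qed

text \<open>An eigenvalue other than \<open>r\<close> that is closer than the gap above
  \<open>r\<close> must lie below \<open>r\<close>.\<close>

lemma limit_point_below: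
  assumes "\<And>e. e > 0 \<Longrightarrow> \<exists>l\<in>\<Lambda>. \<alpha> l \<noteq> r \<and> \<bar>\<alpha> l - r\<bar> < e" "e > 0"
  shows "\<exists>l\<in>\<Lambda>. r - e < \<alpha> l \<and> \<alpha> l < r"
proof -
  obtain d where d: "d > 0" "\<forall>l\<in>\<Lambda>. r < \<alpha> l \<longrightarrow> r + d \<le> \<alpha> l"
    using gap_above by blast
  then obtain l where "l \<in> \<Lambda>" "\<alpha> l \<noteq> r" "\<bar>\<alpha> l - r\<bar> < min d e"
    using assms(1)[of "min d e"] assms(2) by auto
  then show ?thesis using d(2) by (intro bexI[of _ l]) force+
qed

lemma limit_point_increasing:
  assumes "\<And>e. e > 0 \<Longrightarrow> \<exists>l\<in>\<Lambda>. \<alpha> l \<noteq> r \<and> \<bar>\<alpha> l - r\<bar> < e"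
  obtains k :: "nat \<Rightarrow> 'b" where "range k \<subseteq> \<Lambda>" "strict_mono (\<lambda>n. \<alpha> (k n))" "(\<lambda>n. \<alpha> (k n)) \<longlonglongrightarrow> r"
proof -
  note below = limit_point_below[OF assms]
  have "\<exists>k. \<forall>n. (k n \<in> \<Lambda> \<and> \<alpha> (k n) < r \<and> r - 1 / (real n + 1) < \<alpha> (k n)) \<and> \<alpha> (k n) < \<alpha> (k (Suc n))"
  proof (rule dependent_nat_choice)
    show "\<exists>l. l \<in> \<Lambda> \<and> \<alpha> l < r \<and> r - 1 / (real 0 + 1) < \<alpha> l"
      using below[of 1] by auto
    fix l n assume l: "l \<in> \<Lambda> \<and> \<alpha> l < r \<and> r - 1 / (real n + 1) < \<alpha> l"
    \<comment> \<open>The first entry of the minimum puts the new eigenvalue above the previous one,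
      the second drives the sequence to \<open>r\<close>.\<close>
    then obtain k where "k \<in> \<Lambda>" "r - min (r - \<alpha> l) (1 / (real (Suc n) + 1)) < \<alpha> k" "\<alpha> k < r"
      using below[of "min (r - \<alpha> l) (1 / (real (Suc n) + 1))"] by auto
    then show "\<exists>k. (k \<in> \<Lambda> \<and> \<alpha> k < r \<and> r - 1 / (real (Suc n) + 1) < \<alpha> k) \<and> \<alpha> l < \<alpha> k"
      by (intro exI[of _ k]) linarith
  qed
  then obtain k where k: "\<And>n. k n \<in> \<Lambda>" "\<And>n. \<alpha> (k n) < r" "\<And>n. r - 1 / (real n + 1) < \<alpha> (k n)"
    "\<And>n. \<alpha> (k n) < \<alpha> (k (Suc n))"
    by blast
  have "(\<lambda>n. \<alpha> (k n)) \<longlonglongrightarrow> r"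
  proof (rule tendsto_sandwich[OF _ _ _ tendsto_const])
    show "(\<lambda>n. r - inverse (real (Suc n))) \<longlonglongrightarrow> r"
      using LIMSEQ_inverse_real_of_nat_add_minus[of r] by simp
    show "\<forall>\<^sub>F n in sequentially. r - inverse (real (Suc n)) \<le> \<alpha> (k n)"
      using k(3) by (intro always_eventually) (simp add: inverse_eq_divide add.commute less_imp_le)
    show "\<forall>\<^sub>F n in sequentially. \<alpha> (k n) \<le> r"
      using k(2) by (intro always_eventually) (simp add: less_imp_le)
  qed
  then show thesis
    using k by (intro that[of k]) (auto simp: strict_mono_Suc_iff)
qed

text \<open>The open gap above \<open>r\<close> contains no eigenvalue, hence no point of the
  closure of the eigenvalues either.\<close>

lemma not_limit_from_above:
  assumes s: "\<And>n. complex_of_real (s n) \<in> spectrum T" "\<And>n. r < s n"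
  shows "\<not> s \<longlonglongrightarrow> r"
proof
  assume lim: "s \<longlonglongrightarrow> r"
  obtain d where d: "d > 0" "\<And>l. l \<in> \<Lambda> \<Longrightarrow> r < \<alpha> l \<Longrightarrow> r + d \<le> \<alpha> l"
    using gap_above by blast
  then obtain n where n: "\<bar>s n - r\<bar> < d"
    using LIMSEQ_D[OF lim d(1)] by (metis order_refl real_norm_def)
  \<comment> \<open>The ball of radius \<open>e\<close> around \<open>s n\<close> stays inside the
    gap.\<close>
  define e where "e = min (s n - r) (r + d - s n)"
  have "e > 0" using n s(2)[of n] by (auto simp: e_def)
  then obtain l where l: "l \<in> \<Lambda>" "\<bar>\<alpha> l - s n\<bar> < e"
    using s(1)[of n] of_real_in_spectrum by blast
  then have "r < \<alpha> l" "\<alpha> l < r + d"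
    by (auto simp: e_def abs_less_iff)
  then show False using d(2)[OF l(1)] by simp
qed

text \<open>A sequence of eigenvalues increasing strictly to \<open>r\<close> uses distinct indices,
  all but finitely many of them within \<open>e\<close>.\<close>

lemma limit_point_infinite_near:
  assumes "\<And>e. e > 0 \<Longrightarrow> \<exists>l\<in>\<Lambda>. \<alpha> l \<noteq> r \<and> \<bar>\<alpha> l - r\<bar> < e" "e > 0"
  shows "infinite {l \<in> \<Lambda>. \<bar>\<alpha> l - r\<bar> < e}"
proof
  assume fin: "finite {l \<in> \<Lambda>. \<bar>\<alpha> l - r\<bar> < e}"
  obtain k :: "nat \<Rightarrow> 'b" where k: "range k \<subseteq> \<Lambda>" "strict_mono (\<lambda>n. \<alpha> (k n))" "(\<lambda>n. \<alpha> (k n)) \<longlonglongrightarrow> r"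
    using limit_point_increasing[OF assms(1)] by blast
  obtain N where N: "\<And>n. n \<ge> N \<Longrightarrow> \<bar>\<alpha> (k n) - r\<bar> < e"
    using k(3) \<open>e > 0\<close> by (auto simp: LIMSEQ_iff)
  have "inj k"
    using k(2) by (metis injI strict_mono_eq)
  then have "infinite (k ` {N..})"
    by (meson finite_imageD infinite_Ici inj_on_subset subset_UNIV)
  moreover have "k ` {N..} \<subseteq> {l \<in> \<Lambda>. \<bar>\<alpha> l - r\<bar> < e}"
    using k(1) N by auto
  ultimately show False using fin finite_subset by blast
qed

section \<open>Uniqueness of the accumulation point\<close>

lemma infinite_near_if_accumulated:
  assumes "z islimpt spectrum T \<or> infinite_multiplicity T z"
  obtains r where "z = complex_of_real r" "\<And>e. e > 0 \<Longrightarrow> infinite {l \<in> \<Lambda>. \<bar>\<alpha> l - r\<bar> < e}"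
  using assms
proof
  assume "z islimpt spectrum T"
  then show thesis
    using that limit_point_infinite_near by (elim limit_pointE) blast
next
  assume "infinite_multiplicity T z"
  then obtain r where r: "z = complex_of_real r" "infinite {l \<in> \<Lambda>. \<alpha> l = r}"
    using infinite_multiplicityE by blast
  have "infinite {l \<in> \<Lambda>. \<bar>\<alpha> l - r\<bar> < e}" if "e > 0" for e
    using r(2) that by (elim infinite_super[rotated]) auto
  then show thesis using that r(1) by blast
qed

text \<open>The disjunctions let one statement yield uniqueness of the limit point, uniqueness of
  the eigenvalue of infinite multiplicity, and their equality.\<close>

lemma accumulated_unique:
  assumes "a islimpt spectrum T \<or> infinite_multiplicity T a"
    and "b islimpt spectrum T \<or> infinite_multiplicity T b"
  shows "a = b"
proof -
  obtain r where r: "a = complex_of_real r" "\<And>e. e > 0 \<Longrightarrow> infinite {l \<in> \<Lambda>. \<bar>\<alpha> l - r\<bar> < e}"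
    using infinite_near_if_accumulated[OF assms(1)] by blast
  moreover obtain s where s: "b = complex_of_real s"
    "\<And>e. e > 0 \<Longrightarrow> infinite {l \<in> \<Lambda>. \<bar>\<alpha> l - s\<bar> < e}"
    using infinite_near_if_accumulated[OF assms(2)] by blast
  ultimately show ?thesis using infinite_near_unique[OF r(2) s(2)] by simp
qed

lemma countable_point_spectrum: "countable (point_spectrum T)"
proof -
  have "countable (\<alpha> ` \<Lambda>)"
  proof (rule countable_if_minima)
    fix B assume B: "B \<subseteq> \<alpha> ` \<Lambda>" "B \<noteq> {}"
    then have "\<exists>g\<in>{l \<in> \<Lambda>. \<alpha> l \<in> B}. \<forall>l\<in>{l \<in> \<Lambda>. \<alpha> l \<in> B}. \<alpha> g \<le> \<alpha> l"
      by (intro eigenvalue_minimum) auto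
    then show "\<exists>m\<in>B. \<forall>x\<in>B. m \<le> x" using B by blast
  qed
  then have "countable (complex_of_real ` \<alpha> ` \<Lambda>)" by (rule countable_image)
  then show ?thesis
    using point_spectrum_subset by (simp add: image_image countable_subset)
qed

end

theorem theorem4p8:
  fixes T :: "'a::chilbert_space \<Rightarrow> 'a"
  assumes infinite_dim: "\<not> cfinite_dim (UNIV :: 'a set)"
    and T: "T \<in> AM_plus"
  shows "\<exists>(\<Lambda> :: 'a set) (u :: 'a \<Rightarrow> 'a) (\<alpha> :: 'a \<Rightarrow> real).
     orthonormal_basis \<Lambda> u
   \<and> (\<forall>l\<in>\<Lambda>. T (u l) = complex_of_real (\<alpha> l) *\<^sub>C u l)
   \<and> (\<forall>x. ((\<lambda>l. (complex_of_real (\<alpha> l) * cinner x (u l)) *\<^sub>C u l) has_sum T x) \<Lambda>)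
   \<and> (\<forall>\<Gamma>. \<Gamma> \<subseteq> \<Lambda> \<and> \<Gamma> \<noteq> {} \<longrightarrow>
        (\<exists>g\<in>\<Gamma>. \<alpha> g = (INF l\<in>\<Gamma>. \<alpha> l) \<and> (\<forall>l\<in>\<Gamma>. \<alpha> g \<le> \<alpha> l)))
   \<and> spectrum T = closure ((\<lambda>l. complex_of_real (\<alpha> l)) ` \<Lambda>)
   \<and> (\<forall>a b. a islimpt spectrum T \<and> b islimpt spectrum T \<longrightarrow> a = b)
   \<and> (\<forall>a. a islimpt spectrum T \<longrightarrow>
        (\<exists>r :: real. a = complex_of_real r
           \<and> (\<exists>s :: nat \<Rightarrow> real. strict_mono s \<and> (\<forall>n. complex_of_real (s n) \<in> spectrum T)
                \<and> s \<longlonglongrightarrow> r)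
           \<and> \<not> (\<exists>s :: nat \<Rightarrow> real. (\<forall>n. complex_of_real (s n) \<in> spectrum T \<and> r < s n)
                \<and> s \<longlonglongrightarrow> r)))
   \<and> countable (point_spectrum T)
   \<and> (\<forall>a b. infinite_multiplicity T a \<and> infinite_multiplicity T b \<longrightarrow> a = b)
   \<and> (\<forall>a b. a islimpt spectrum T \<and> infinite_multiplicity T b \<longrightarrow> a = b)"
proof -
  obtain E where E: "orthonormal_basis E (\<lambda>x. x)"
    "\<And>x. x \<in> E \<Longrightarrow> T x = complex_of_real (norm (T x)) *\<^sub>C x"
    using AM_plus_eigenbasis[OF T] by blast
  \<comment> \<open>The basis is indexed by its own vectors, with \<open>norm (T x)\<close> as the
    eigenvalue at \<open>x\<close>.\<close>
  interpret AM_diagonal T E "\<lambda>x. x" "\<lambda>x. norm (T x)"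
    using T E by unfold_locales (auto simp: AM_plus_def positive_operator_def)
  show ?thesis
  proof (rule exI[of _ E], rule exI[of _ "\<lambda>x. x"], rule exI[of _ "\<lambda>x. norm (T x)"],
      intro conjI allI impI ballI)
    show "\<exists>g\<in>\<Gamma>. norm (T g) = (INF l\<in>\<Gamma>. norm (T l)) \<and> (\<forall>l\<in>\<Gamma>. norm (T g) \<le> norm (T l))"
      if \<Gamma>: "\<Gamma> \<subseteq> E \<and> \<Gamma> \<noteq> {}" for \<Gamma>
    proof -
      obtain g where g: "g \<in> \<Gamma>" "\<forall>l\<in>\<Gamma>. norm (T g) \<le> norm (T l)"
        using eigenvalue_minimum \<Gamma> by blast
      then have "(INF l\<in>\<Gamma>. norm (T l)) = norm (T g)"
        by (intro cInf_eq_minimum) auto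
      with g show ?thesis by auto
    qed
    show "\<exists>r. a = complex_of_real r
           \<and> (\<exists>s :: nat \<Rightarrow> real. strict_mono s \<and> (\<forall>n. complex_of_real (s n) \<in> spectrum T)
                \<and> s \<longlonglongrightarrow> r)
           \<and> \<not> (\<exists>s :: nat \<Rightarrow> real. (\<forall>n. complex_of_real (s n) \<in> spectrum T \<and> r < s n)
                \<and> s \<longlonglongrightarrow> r)" if a: "a islimpt spectrum T" for a
    proof -
      obtain r where r: "a = complex_of_real r"
        "\<And>e. e > 0 \<Longrightarrow> \<exists>l\<in>E. norm (T l) \<noteq> r \<and> \<bar>norm (T l) - r\<bar> < e"
        using limit_pointE[OF a] by blast
      obtain k :: "nat \<Rightarrow> 'a" where k: "range k \<subseteq> E" "strict_mono (\<lambda>n. norm (T (k n)))"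
        "(\<lambda>n. norm (T (k n))) \<longlonglongrightarrow> r"
        using limit_point_increasing[OF r(2)] by blast
      have "complex_of_real (norm (T (k n))) \<in> spectrum T" for n
        unfolding spectrum_eq using k(1) by (intro subsetD[OF closure_subset]) auto
      then show ?thesis
        using r(1) k(2,3) not_limit_from_above by blast
    qed
  qed (use E has_sum_operator spectrum_eq accumulated_unique countable_point_spectrum in auto)
qed

end
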